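(* Let $k \ge 1$ be an integer. In every $k$-game (with any card number $m\ge k$ and any initial deal of $k$ nonempty stacks chosen by the demon) whose stack profile $(n_1,\dots,n_k)$ has at most one index $i$ with $n_i = 1$, the player (called Atticus) has a winning strategy against Vizing's Demon.
   Context: The solitaire game. Fix an integer $k\ge 1$ (the game number). The demon chooses an integer $m\ge k$ (the card number) and takes a deck consisting of exactly $k$ cards of each type $1,2,\dots,m$ (a card of type $a$ is called an $a$-card). The demon deals $k$ nonempty stacks from the deck, numbered $1,\dots,k$, such that each stack contains at most one card of each type; the number of cards $n_i\ge 1$ in stack $i$ is up to the demon, and $(n_1,\dots,n_k)$ is called the stack profile. The remaining cards of the deck form the reserve. All cards (stacks and reserve) are visible. Thus a position amounts to a $k$-tuple $(S_1,\dots,S_k)$ of nonempty subsets of $\{1,\dots,m\}$, where $S_i$ is the set of types in stack $i$; since there are $k$ cards of each type, whenever some stack has no $b$-card the reserve contains a $b$-card. Such a game is called a $k$-game. Play proceeds in turns. At the start of a turn the player wins if she can make a hand of $k$ differently numbered cards by picking one card from each stack (i.e. there are pairwise distinct $c_1,\dots,c_k$ with $c_i\in S_i$ for all $i$); this includes the start of the first turn. Otherwise the player makes a move: she picks some stack $i$ containing an $a$-card but no $b$-card and swaps the $a$-card for a $b$-card from the reserve (so $S_i$ is replaced by $(S_i\setminus\{a\})\cup\{b\}$). Then the demon responds, and the next turn begins. Vizing's Demon: if the player has just swapped an $a$-card out of and a $b$-card into the $i$-th stack, the demon does exactly one of the following: (1) nothing; (2) picks one stack other than the $i$-th which contains a $b$-card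 but no $a$-card and swaps that $b$-card for an $a$-card from the reserve; (3) picks one stack other than the $i$-th which contains an $a$-card but no $b$-card and swaps that $a$-card for a $b$-card from the reserve. A winning strategy for the player against a given demon is a way of choosing moves, depending on the play so far, that guarantees that the player wins after finitely many turns, whatever responses permitted to that demon are chosen. *)

theory Defs
  imports Main
begin

text \<open>
  A position maps each stack number in \<open>{1..k}\<close> to the set of card types in that stack; values
  outside \<open>{1..k}\<close> are irrelevant.  The deck has \<open>k\<close> cards of each type, so whenever some stack
  lacks type \<open>b\<close> the reserve holds a \<open>b\<close>-card; hence the reserve need not be recorded.
\<close>

type_synonym position = "nat \<Rightarrow> nat set"

definition k_game :: "nat \<Rightarrow> nat \<Rightarrow> position \<Rightarrow> bool" where
  "k_game k m S \<longleftrightarrow> 1 \<le> k \<and> k \<le> m \<and> (\<forall>i\<in>{1..k}. S i \<noteq> {} \<and> S i \<subseteq> {1..m})"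

definition stack_profile :: "position \<Rightarrow> nat \<Rightarrow> nat" where
  "stack_profile S i = card (S i)"

definition winning_position :: "nat \<Rightarrow> position \<Rightarrow> bool" where
  "winning_position k S \<longleftrightarrow> (\<exists>c. inj_on c {1..k} \<and> (\<forall>i\<in>{1..k}. c i \<in> S i))"

text \<open>The swap \<open>(i, a, b)\<close> takes an \<open>a\<close>-card out of stack \<open>i\<close> and puts a \<open>b\<close>-card in.\<close>

type_synonym swap = "nat \<times> nat \<times> nat"

fun apply_swap :: "swap \<Rightarrow> position \<Rightarrow> position" where
  "apply_swap (i, a, b) S = S(i := insert b (S i - {a}))"

fun legal_move :: "nat \<Rightarrow> nat \<Rightarrow> position \<Rightarrow> swap \<Rightarrow> bool" where
  "legal_move k m S (i, a, b) \<longleftrightarrow> i \<in> {1..k} \<and> b \<in> {1..m} \<and> a \<in> S i \<and> b \<notin> S i"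

text \<open>
  A response of the demon is \<open>None\<close> (nothing) or one swap.  In \<open>vizing_response k T mv r\<close>,
  \<open>T\<close> is the position reached by the player's move \<open>mv\<close>.
\<close>

fun vizing_response :: "nat \<Rightarrow> position \<Rightarrow> swap \<Rightarrow> swap option \<Rightarrow> bool" where
  "vizing_response k T (i, a, b) r \<longleftrightarrow>
     r = None \<or>
     (\<exists>j\<in>{1..k}. j \<noteq> i \<and> b \<in> T j \<and> a \<notin> T j \<and> r = Some (j, b, a)) \<or>
     (\<exists>j\<in>{1..k}. j \<noteq> i \<and> a \<in> T j \<and> b \<notin> T j \<and> r = Some (j, a, b))"

fun apply_response :: "swap option \<Rightarrow> position \<Rightarrow> position" where
  "apply_response None T = T"
| "apply_response (Some sw) T = apply_swap sw T"

text \<open>A history lists the completed turns, oldest first, as pairs of a move and a response.\<close>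

type_synonym history = "(swap \<times> swap option) list"

fun position_after :: "position \<Rightarrow> history \<Rightarrow> position" where
  "position_after S [] = S"
| "position_after S ((mv, r) # h) = position_after (apply_response r (apply_swap mv S)) h"

type_synonym strategy = "history \<Rightarrow> swap"

inductive play :: "nat \<Rightarrow> nat \<Rightarrow> position \<Rightarrow> strategy \<Rightarrow> history \<Rightarrow> bool"
  for k m :: nat and S :: position and \<sigma> :: strategy where
  start: "play k m S \<sigma> []"
| turn: "play k m S \<sigma> (h @ [(\<sigma> h, r)])"
    if "play k m S \<sigma> h"
      and "\<not> winning_position k (position_after S h)"
      and "legal_move k m (position_after S h) (\<sigma> h)"
      and "vizing_response k (apply_swap (\<sigma> h) (position_after S h)) (\<sigma> h) r"

text \<open>
  A strategy is winning if it supplies a legal move whenever the player has not yet won and no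
  play following it goes on forever.  A play is never continued past a winning position, and
  the demon always has a permitted response, so a play that cannot be continued has been won.
\<close>

definition winning_strategy :: "nat \<Rightarrow> nat \<Rightarrow> position \<Rightarrow> strategy \<Rightarrow> bool" where
  "winning_strategy k m S \<sigma> \<longleftrightarrow>
     (\<forall>h. play k m S \<sigma> h \<longrightarrow> \<not> winning_position k (position_after S h) \<longrightarrow>
        legal_move k m (position_after S h) (\<sigma> h)) \<and>
     \<not> (\<exists>f. \<forall>n. play k m S \<sigma> (map f [0..<n]))"

end

theory Submission
  imports Defs
begin

text \<open>
  The strategy transfers to the game the proof of Vizing's theorem by Ehrenfeucht, Faber and
  Kierstead.  Atticus settles the stacks one after another.  At any time there is a set \<open>I\<close> of
  unsettled stacks and a set \<open>C\<close> of unused types with \<open>card I \<le> card C\<close>; the settled stacks already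
  show distinct types outside \<open>C\<close>.  As Atticus swaps only types in \<open>C\<close>, and the demon can answer
  only with the same two types, what has been settled stays settled.

  Within the unsettled stacks she attends to a selection \<open>T\<close> of exactly one card from one stack
  and exactly two cards from every other.  A type in \<open>C\<close> selected in exactly one stack \<open>u\<close> settles
  \<open>u\<close>: the other selections survive the removal of that type, so at most one of the remaining
  stacks has a single usable card.  If there is no such type, a count decides.  The selection has
  \<open>2 * card I - 1\<close> cards, which is odd, so some type \<open>a\<close> is selected an odd number of times, hence at
  least three times; and if every type in \<open>C\<close> were selected at least twice, there would be more than
  \<open>2 * card C\<close> cards.  So some type \<open>b\<close> is not selected at all (\<open>unique_or_odd_and_unselected\<close>).
  Atticus swaps a selected \<open>a\<close> for \<open>b\<close>.  Since no selected card is a \<open>b\<close>, the demon can alter the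
  selection only by changing a second \<open>a\<close> into \<open>b\<close>.  Either way \<open>a\<close> is still selected, \<open>b\<close> has
  become selected, and there are fewer unselected types than before.

  Termination is expressed by an inductive predicate of positions, from which a strategy is
  assembled afterwards.
\<close>

section \<open>From inductively won positions to strategies\<close>

inductive forced_win :: "nat \<Rightarrow> nat \<Rightarrow> position \<Rightarrow> bool" for k m :: nat where
  won: "winning_position k S \<Longrightarrow> forced_win k m S"
| move: "legal_move k m S mv \<Longrightarrow>
    (\<And>r. vizing_response k (apply_swap mv S) mv r \<Longrightarrow>
       forced_win k m (apply_response r (apply_swap mv S))) \<Longrightarrow>
    forced_win k m S"

text \<open>
  A strategy sees the whole history, so after the demon's first response \<open>r\<close> Atticus can follow
  whatever strategy \<open>\<tau> r\<close> wins from the position then reached.  The strategies chosen for different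
  responses need not agree on positions that they share.
\<close>

definition first_then :: "swap \<Rightarrow> (swap option \<Rightarrow> strategy) \<Rightarrow> strategy" where
  "first_then mv \<tau> h = (case h of [] \<Rightarrow> mv | (_, r) # h' \<Rightarrow> \<tau> r h')"

lemma play_first_then:
  assumes "play k m S (first_then mv \<tau>) h"
  shows "h = [] \<or> (\<exists>r h'. h = (mv, r) # h' \<and> vizing_response k (apply_swap mv S) mv r \<and>
           play k m (apply_response r (apply_swap mv S)) (\<tau> r) h')"
  using assms
proof induction
  case start
  then show ?case by simp
next
  case (turn h r)
  from turn.IH show ?case
  proof (elim disjE exE conjE)
    assume "h = []"
    then show ?thesis
      using turn.hyps by (auto simp: first_then_def intro: play.start)
  next
    fix r' h'
    assume h: "h = (mv, r') # h'" and resp: "vizing_response k (apply_swap mv S) mv r'"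
      and p: "play k m (apply_response r' (apply_swap mv S)) (\<tau> r') h'"
    have \<sigma>: "first_then mv \<tau> h = \<tau> r' h'"
      by (simp add: h first_then_def)
    have "play k m (apply_response r' (apply_swap mv S)) (\<tau> r') (h' @ [(\<tau> r' h', r)])"
      using turn.hyps(2-4) unfolding \<sigma> unfolding h by (intro play.turn p) simp_all
    then show ?thesis
      using resp unfolding \<sigma> unfolding h by simp
  qed
qed

lemma winning_strategy_first_then:
  assumes legal: "legal_move k m S mv"
    and \<tau>: "\<And>r. vizing_response k (apply_swap mv S) mv r \<Longrightarrow>
      winning_strategy k m (apply_response r (apply_swap mv S)) (\<tau> r)"
  shows "winning_strategy k m S (first_then mv \<tau>)"
  unfolding winning_strategy_def
proof (intro conjI allI impI notI)
  fix h
  assume p: "play k m S (first_then mv \<tau>) h" and nw: "\<not> winning_position k (position_after S h)"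
  from play_first_then[OF p]
  show "legal_move k m (position_after S h) (first_then mv \<tau> h)"
  proof (elim disjE exE conjE)
    assume "h = []"
    then show ?thesis using legal by (simp add: first_then_def)
  next
    fix r h'
    assume h: "h = (mv, r) # h'" and "vizing_response k (apply_swap mv S) mv r"
      and p': "play k m (apply_response r (apply_swap mv S)) (\<tau> r) h'"
    then have "winning_strategy k m (apply_response r (apply_swap mv S)) (\<tau> r)"
      using \<tau> by blast
    then show ?thesis
      using p' nw unfolding h by (simp add: winning_strategy_def first_then_def)
  qed
next
  assume "\<exists>f. \<forall>n. play k m S (first_then mv \<tau>) (map f [0..<n])"
  then obtain f where f: "play k m S (first_then mv \<tau>) (map f [0..<n])" for n
    by blast
  have shifted: "vizing_response k (apply_swap mv S) mv (snd (f 0)) \<and>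
      play k m (apply_response (snd (f 0)) (apply_swap mv S)) (\<tau> (snd (f 0)))
        (map (\<lambda>i. f (Suc i)) [0..<n])" for n
    using play_first_then[OF f[of "Suc n"]] unfolding map_upt_Suc by force
  with \<tau> have "winning_strategy k m (apply_response (snd (f 0)) (apply_swap mv S)) (\<tau> (snd (f 0)))"
    by blast
  with shifted show False
    unfolding winning_strategy_def by blast
qed

lemma forced_win_imp_winning_strategy:
  assumes "forced_win k m S"
  shows "\<exists>\<sigma>. winning_strategy k m S \<sigma>"
  using assms
proof induction
  case (won S)
  have only_Nil: "h = []" if "play k m S \<sigma> h" for \<sigma> h
    using that by induction (use won in auto)
  have "\<not> (\<forall>n. play k m S \<sigma> (map f [0..<n]))" for \<sigma> f
  proof
    assume "\<forall>n. play k m S \<sigma> (map f [0..<n])"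
    then show False using only_Nil[of \<sigma> "map f [0..<1]"] by (auto dest: spec[of _ 1])
  qed
  then show ?case
    using won only_Nil unfolding winning_strategy_def by fastforce
next
  case (move S mv)
  then obtain \<tau> where "\<And>r. vizing_response k (apply_swap mv S) mv r \<Longrightarrow>
      winning_strategy k m (apply_response r (apply_swap mv S)) (\<tau> r)"
    by metis
  then show ?case
    using winning_strategy_first_then[OF move.hyps(1)] by blast
qed

section \<open>Settled stacks\<close>

definition settled_outside :: "nat \<Rightarrow> position \<Rightarrow> nat set \<Rightarrow> nat set \<Rightarrow> bool" where
  "settled_outside k S I C \<longleftrightarrow>
     (\<exists>c. inj_on c ({1..k} - I) \<and> (\<forall>i\<in>{1..k} - I. c i \<in> S i - C))"

lemma settled_outside_swap:
  assumes "settled_outside k S I C" "a \<in> C"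
  shows "settled_outside k (apply_swap (j, a, b) S) I C"
  using assms unfolding settled_outside_def by fastforce

lemma settled_outside_add:
  assumes "settled_outside k S I C" "c \<in> C" "c \<in> S u"
  shows "settled_outside k S (I - {u}) (C - {c})"
proof -
  obtain d where d: "inj_on d ({1..k} - I)" "\<forall>i\<in>{1..k} - I. d i \<in> S i - C"
    using assms(1) unfolding settled_outside_def by blast
  have "inj_on (\<lambda>i. if i \<in> I then c else d i) ({1..k} - (I - {u}))"
    using d assms(2) unfolding inj_on_def by (auto; metis)
  moreover have "\<forall>i\<in>{1..k} - (I - {u}). (if i \<in> I then c else d i) \<in> S i - (C - {c})"
    using d assms(2,3) by auto
  ultimately show ?thesis
    unfolding settled_outside_def by blast
qed

section \<open>Selections of one or two cards per stack\<close>

text \<open>The distinguished stack \<open>v\<close> contributes a single card, which makes the selection odd.\<close>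

definition selection :: "nat \<Rightarrow> nat set \<Rightarrow> nat set \<Rightarrow> position \<Rightarrow> bool" where
  "selection v I C T \<longleftrightarrow> v \<in> I \<and> card (T v) = 1 \<and>
     (\<forall>i\<in>I - {v}. card (T i) = 2) \<and> (\<forall>i\<in>I. T i \<subseteq> C)"

definition holders :: "nat set \<Rightarrow> position \<Rightarrow> nat \<Rightarrow> nat set" where
  "holders I T c = {i \<in> I. c \<in> T i}"

text \<open>Both sides count the selected cards, by type and by stack.\<close>

lemma sum_card_holders:
  assumes "finite I" "finite C" "selection v I C T"
  shows "(\<Sum>c\<in>C. card (holders I T c)) = 2 * card I - 1"
proof -
  have "(\<Sum>c\<in>C. card (holders I T c)) = (\<Sum>i\<in>I. card {c \<in> C. c \<in> T i})"
    unfolding holders_def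
    using sum_multicount_gen[of I C "\<lambda>i c. c \<in> T i" "\<lambda>c. card {i \<in> I. c \<in> T i}"] assms by simp
  also have "\<dots> = (\<Sum>i\<in>I. card (T i))"
  proof (rule sum.cong)
    fix i assume "i \<in> I"
    then have "{c \<in> C. c \<in> T i} = T i"
      using assms(3) unfolding selection_def by blast
    then show "card {c \<in> C. c \<in> T i} = card (T i)" by simp
  qed simp
  also have "\<dots> = card (T v) + (\<Sum>i\<in>I - {v}. card (T i))"
    using assms by (intro sum.remove) (auto simp: selection_def)
  also have "\<dots> = 1 + 2 * card (I - {v})"
    using assms(3) by (simp add: selection_def)
  also have "\<dots> = 2 * card I - 1"
  proof -
    have "v \<in> I" using assms(3) by (simp add: selection_def)
    then show ?thesis
      using card_Suc_Diff1[OF assms(1)] by fastforce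
  qed
  finally show ?thesis .
qed

text \<open>
  The number of selected cards is odd and less than \<open>2 * card C\<close>.  Oddness yields \<open>a\<close>; the bound
  yields \<open>b\<close>, for otherwise every type in \<open>C\<close> would be selected twice or more.
\<close>

lemma unique_or_odd_and_unselected:
  assumes fin: "finite I" "finite C" and sel: "selection v I C T" and le: "card I \<le> card C"
  obtains (unique) c u where "c \<in> C" "holders I T c = {u}"
  | (move) a b where "a \<in> C" "b \<in> C" "3 \<le> card (holders I T a)" "holders I T b = {}"
proof (cases "\<exists>c\<in>C. card (holders I T c) = 1")
  case True
  then show ?thesis
    using unique card_1_singletonE by blast
next
  case no_unique: False
  have "card I > 0"
    using sel fin by (auto simp: selection_def card_gt_0_iff)
  then have "odd (\<Sum>c\<in>C. card (holders I T c))"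
    using sum_card_holders[OF fin sel] by simp
  then obtain a where a: "a \<in> C" "odd (card (holders I T a))"
    by (meson dvd_sum)
  from a(2) obtain q where "card (holders I T a) = 2 * q + 1"
    by (rule oddE)
  with no_unique a(1) have a3: "3 \<le> card (holders I T a)"
    by (cases q) auto
  have "\<exists>b\<in>C. card (holders I T b) = 0"
  proof (rule ccontr)
    assume "\<not> ?thesis"
    with no_unique have "\<forall>c\<in>C. 2 \<le> card (holders I T c)"
      by (metis less_2_cases not_le One_nat_def)
    then have "(\<Sum>c\<in>C - {a}. 2) \<le> (\<Sum>c\<in>C - {a}. card (holders I T c))"
      by (intro sum_mono) auto
    then have "3 + 2 * card (C - {a}) \<le> (\<Sum>c\<in>C. card (holders I T c))"
      using a3 sum.remove[OF fin(2) a(1), of "\<lambda>c. card (holders I T c)"] by simp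
    then show False
      using sum_card_holders[OF fin sel] le card_Suc_Diff1[OF fin(2) a(1)] by linarith
  qed
  then obtain b where "b \<in> C" "holders I T b = {}"
    using fin by (auto simp: holders_def)
  then show ?thesis
    using move a(1) a3 by blast
qed

definition exchange :: "nat \<Rightarrow> nat \<Rightarrow> nat set \<Rightarrow> position \<Rightarrow> position" where
  "exchange a b J T i = (if i \<in> J then insert b (T i - {a}) else T i)"

lemma selection_exchange:
  assumes "selection v I C T" "J \<subseteq> holders I T a" "holders I T b = {}" "b \<in> C"
  shows "selection v I C (exchange a b J T)"
proof -
  have card_eq: "card (exchange a b J T i) = card (T i)" if "i \<in> I" for i
  proof (cases "i \<in> J")
    case True
    have "card (T i) \<noteq> 0"
      using assms(1) that unfolding selection_def by (cases "i = v") auto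
    then have "finite (T i)" "a \<in> T i" "b \<notin> T i"
      using True that assms(2,3) by (auto simp: holders_def intro: card_ge_0_finite)
    then show ?thesis
      using True card_Suc_Diff1[of "T i" a] by (simp add: exchange_def)
  qed (simp add: exchange_def)
  have "exchange a b J T i \<subseteq> C" if "i \<in> I" for i
    using assms(1,4) that unfolding selection_def exchange_def by auto
  with card_eq assms(1) show ?thesis
    unfolding selection_def by simp
qed

text \<open>
  Exchanging fewer cards than there are holders of \<open>a\<close> leaves \<open>a\<close> selected, so \<open>b\<close> is gained and
  no type is lost.
\<close>

lemma unselected_exchange_psubset:
  assumes fin: "finite I" and J: "J \<subseteq> holders I T a" "J \<noteq> {}" "card J < card (holders I T a)"
    and b: "b \<in> C" "holders I T b = {}"
  shows "{c \<in> C. holders I (exchange a b J T) c = {}} \<subset> {c \<in> C. holders I T c = {}}"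
proof -
  obtain i where i: "i \<in> holders I T a" "i \<notin> J"
    using J by (metis nat_less_le subsetI subset_antisym)
  have "holders I (exchange a b J T) a \<noteq> {}"
    using i by (auto simp: holders_def exchange_def)
  moreover have "holders I T c \<subseteq> holders I (exchange a b J T) c" if "c \<noteq> a" for c
    using that by (auto simp: holders_def exchange_def)
  ultimately have "holders I T c = {}" if "holders I (exchange a b J T) c = {}" for c
    using that by (cases "c = a") auto
  moreover have "holders I (exchange a b J T) b \<noteq> {}"
    using J by (auto simp: holders_def exchange_def)
  ultimately show ?thesis
    using b by (intro psubsetI subsetI notI) auto
qed

section \<open>The strategy\<close>

text \<open>
  After Atticus exchanges \<open>a\<close> for \<open>b\<close> in stack \<open>i\<close>, the demon's swap in a stack \<open>j\<close> matters to the
  selection only if it takes a selected \<open>a\<close> out of \<open>j\<close>, since no \<open>b\<close> is selected there.  In that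
  case the selection follows the demon and is exchanged in \<open>j\<close> as well.
\<close>

lemma selection_follows_response:
  assumes sub: "\<forall>l\<in>I. T l \<subseteq> S l" and i: "i \<in> holders I T a" and b: "holders I T b = {}"
    and resp: "vizing_response k (apply_swap (i, a, b) S) (i, a, b) r"
  obtains J where "J \<subseteq> holders I T a" "J \<noteq> {}" "card J \<le> 2"
    "\<forall>l\<in>I. exchange a b J T l \<subseteq> apply_response r (apply_swap (i, a, b) S) l"
proof (cases "\<exists>j \<in> holders I T a. j \<noteq> i \<and> r = Some (j, a, b)")
  case True
  then obtain j where j: "j \<in> holders I T a" "j \<noteq> i" "r = Some (j, a, b)"
    by blast
  show ?thesis
  proof (rule that[of "{i, j}"])
    show "card {i, j} \<le> 2"
      by (simp add: card_insert_if)
    show "\<forall>l\<in>I. exchange a b {i, j} T l \<subseteq> apply_response r (apply_swap (i, a, b) S) l"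
      using sub j by (auto simp: exchange_def)
  qed (use i j in auto)
next
  case False
  show ?thesis
  proof (rule that[of "{i}"])
    show "\<forall>l\<in>I. exchange a b {i} T l \<subseteq> apply_response r (apply_swap (i, a, b) S) l"
    proof (intro ballI subsetI)
      fix l x
      assume l: "l \<in> I" and x: "x \<in> exchange a b {i} T l"
      have "x \<in> T l \<Longrightarrow> x \<in> S l" "b \<notin> T l"
        using sub b l by (auto simp: holders_def)
      then show "x \<in> apply_response r (apply_swap (i, a, b) S) l"
        using resp False l x by (auto simp: exchange_def holders_def split: if_splits)
    qed
  qed (use i in auto)
qed

lemma settled_outside_response:
  assumes "settled_outside k S I C" "a \<in> C" "b \<in> C"
    and "vizing_response k (apply_swap (i, a, b) S) (i, a, b) r"
  shows "settled_outside k (apply_response r (apply_swap (i, a, b) S)) I C"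
  using assms(2-4) settled_outside_swap[OF assms(1,2), of i b]
  by (auto intro: settled_outside_swap simp del: apply_swap.simps)

text \<open>
  Atticus either settles a stack, which is left to \<open>settle\<close>, or makes another type selected.  The
  exchange of \<open>a\<close> for \<open>b\<close> in stack \<open>i\<close> costs a turn only if \<open>b\<close> is not already in that stack.
\<close>

lemma forced_win_selection:
  assumes I: "I \<subseteq> {1..k}" and C: "C \<subseteq> {1..m}" and le: "card I \<le> card C"
    and settle: "\<And>S T c u. settled_outside k S I C \<Longrightarrow> selection v I C T \<Longrightarrow>
      \<forall>i\<in>I. T i \<subseteq> S i \<Longrightarrow> c \<in> C \<Longrightarrow> holders I T c = {u} \<Longrightarrow> forced_win k m S"
    and "settled_outside k S I C" "selection v I C T" "\<forall>i\<in>I. T i \<subseteq> S i"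
  shows "forced_win k m S"
  using assms(5-)
proof (induction "card {c \<in> C. holders I T c = {}}" arbitrary: S T rule: less_induct)
  case less
  have fin: "finite I" "finite C"
    using I C finite_subset by blast+
  from fin less.prems(2) le show ?case
  proof (cases rule: unique_or_odd_and_unselected)
    case (unique c u)
    then show ?thesis using settle less.prems by blast
  next
    case (move a b)
    have exchanged: "forced_win k m S'"
      if "J \<subseteq> holders I T a" "J \<noteq> {}" "card J \<le> 2" "settled_outside k S' I C"
        "\<forall>l\<in>I. exchange a b J T l \<subseteq> S' l" for J S'
    proof (rule less.hyps[OF _ that(4) selection_exchange[OF less.prems(2) that(1) move(4,2)] that(5)])
      show "card {c \<in> C. holders I (exchange a b J T) c = {}} < card {c \<in> C. holders I T c = {}}"
        using unselected_exchange_psubset[OF fin(1) that(1,2) _ move(2,4)] that(3) move(3) fin(2)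
        by (intro psubset_card_mono) auto
    qed
    obtain i where i: "i \<in> holders I T a"
      using move(3) by fastforce
    show ?thesis
    proof (cases "b \<in> S i")
      case True
      show ?thesis
      proof (rule exchanged[of "{i}"])
        show "\<forall>l\<in>I. exchange a b {i} T l \<subseteq> S l"
          using True less.prems(3) by (auto simp: exchange_def)
      qed (use i less.prems(1) in auto)
    next
      case False
      show ?thesis
      proof (rule forced_win.move)
        show "legal_move k m S (i, a, b)"
          using False i I C move(2) less.prems(3) by (auto simp: holders_def)
      next
        fix r
        assume resp: "vizing_response k (apply_swap (i, a, b) S) (i, a, b) r"
        from less.prems(3) i move(4) resp obtain J
          where "J \<subseteq> holders I T a" "J \<noteq> {}" "card J \<le> 2"
            "\<forall>l\<in>I. exchange a b J T l \<subseteq> apply_response r (apply_swap (i, a, b) S) l"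
          by (rule selection_follows_response)
        then show "forced_win k m (apply_response r (apply_swap (i, a, b) S))"
          using settled_outside_response[OF less.prems(1) move(1,2) resp] by (intro exchanged)
      qed
    qed
  qed
qed

text \<open>
  Once a stack is settled, a fresh selection is made for the other stacks.  The old one need not
  serve: if the settled stack was the distinguished one, an even number of selected cards is left.
\<close>

lemma forced_win_unsettled:
  assumes "I \<subseteq> {1..k}" "C \<subseteq> {1..m}" "card I \<le> card C" "settled_outside k S I C"
    and "\<forall>i\<in>I. S i \<inter> C \<noteq> {}" "\<forall>i\<in>I - {v}. 2 \<le> card (S i \<inter> C)"
  shows "forced_win k m S"
  using assms
proof (induction "card I" arbitrary: I C S v rule: less_induct)
  case less
  have fin: "finite I"
    using less.prems(1) finite_subset by blast
  show ?case
  proof (cases "I = {}")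
    case True
    then show ?thesis
      using less.prems(4) unfolding settled_outside_def
      by (intro forced_win.won) (simp add: winning_position_def, blast)
  next
    case False
    then obtain w where w: "w \<in> I" and two: "\<forall>i\<in>I - {w}. 2 \<le> card (S i \<inter> C)"
      using less.prems(6) by (cases "v \<in> I") auto
    have "\<exists>X. X \<subseteq> S i \<inter> C \<and> card X = (if i = w then 1 else 2)" if "i \<in> I" for i
    proof (cases "i = w")
      case True
      have "S i \<inter> C \<noteq> {}" using less.prems(5) that by simp
      then obtain x where "x \<in> S i \<inter> C" unfolding ex_in_conv[symmetric] by (rule exE)
      then show ?thesis using True by (intro exI[of _ "{x}"]) simp
    next
      case False
      then have "2 \<le> card (S i \<inter> C)" using two that by simp
      then obtain X where "X \<subseteq> S i \<inter> C" "card X = 2" by (rule obtain_subset_with_card_n)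
      then show ?thesis using False by (intro exI[of _ X]) simp
    qed
    then obtain T where T: "\<forall>i\<in>I. T i \<subseteq> S i \<inter> C \<and> card (T i) = (if i = w then 1 else 2)"
      by metis
    show ?thesis
    proof (rule forced_win_selection[OF less.prems(1-3) _ less.prems(4)])
      show "selection w I C T" "\<forall>i\<in>I. T i \<subseteq> S i"
        using w T by (auto simp: selection_def)
    next
      fix S T c u
      assume settled: "settled_outside k S I C" and sel: "selection w I C T"
        and sub: "\<forall>i\<in>I. T i \<subseteq> S i" and c: "c \<in> C" "holders I T c = {u}"
      have u: "u \<in> I" "c \<in> S u"
        using c(2) sub by (auto simp: holders_def)
      have fin_C: "finite C"
        using less.prems(2) finite_subset by blast
      have T_sub: "T i \<subseteq> S i \<inter> (C - {c})" if "i \<in> I - {u}" for i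
        using that c(2) sub sel unfolding holders_def selection_def by blast
      show "forced_win k m S"
      proof (rule less.hyps[of "I - {u}" "C - {c}" S w])
        show "card (I - {u}) < card I"
          using u(1) fin by (rule card_Diff1_less[rotated])
        show "card (I - {u}) \<le> card (C - {c})"
          using less.prems(3) u(1) c(1) by simp
        show "settled_outside k S (I - {u}) (C - {c})"
          using settled c(1) u(2) by (rule settled_outside_add)
        show "\<forall>i\<in>I - {u}. S i \<inter> (C - {c}) \<noteq> {}"
        proof
          fix i assume i: "i \<in> I - {u}"
          then have "card (T i) \<noteq> 0"
            using sel unfolding selection_def by (cases "i = w") auto
          then show "S i \<inter> (C - {c}) \<noteq> {}"
            using T_sub[OF i] by (metis card.empty subset_empty)
        qed
        show "\<forall>i\<in>I - {u} - {w}. 2 \<le> card (S i \<inter> (C - {c}))"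
        proof
          fix i assume i: "i \<in> I - {u} - {w}"
          then have "card (T i) = 2" using sel by (auto simp: selection_def)
          then show "2 \<le> card (S i \<inter> (C - {c}))"
            using card_mono[OF _ T_sub[of i]] i fin_C by auto
        qed
      qed (use less.prems in auto)
    qed
  qed
qed

theorem theorem2:
  fixes k m :: nat and S :: position
  assumes "k_game k m S"
    and "card {i \<in> {1..k}. stack_profile S i = 1} \<le> 1"
  shows "\<exists>\<sigma>. winning_strategy k m S \<sigma>"
proof (rule forced_win_imp_winning_strategy)
  have S: "S i \<noteq> {}" "S i \<inter> {1..m} = S i" "finite (S i)" if "i \<in> {1..k}" for i
    using assms(1) that finite_subset unfolding k_game_def by blast+
  obtain v where v: "{i \<in> {1..k}. stack_profile S i = 1} \<subseteq> {v}"
    using assms(2) card_le_Suc0_iff_eq[of "{i \<in> {1..k}. stack_profile S i = 1}"]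
    by (cases "{i \<in> {1..k}. stack_profile S i = 1} = {}") auto
  have "2 \<le> card (S i \<inter> {1..m})" if "i \<in> {1..k} - {v}" for i
  proof -
    have "card (S i) \<noteq> 0" "card (S i) \<noteq> 1"
      using that v S[of i] by (auto simp: stack_profile_def)
    then show ?thesis using S(2)[of i] that by simp
  qed
  then show "forced_win k m S"
    using assms(1) S by (intro forced_win_unsettled[of "{1..k}" k "{1..m}" m S v])
      (auto simp: k_game_def settled_outside_def)
qed

end
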